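(* Let $a,b>0$ be the side lengths of an $a\times b$ rectangular billiard table with $a/b$ rational. The number of atomic squares formed by the billiard trajectory in the $a\times b$ rectangle is $$\frac{(a-\gcd(a,b))(b-\gcd(a,b))}{2\,\gcd(a,b)^2}.$$
   Context: The table is the rectangle $[0,a]\times[0,b]$ in the plane, where $a,b>0$ and $a/b$ is rational. Write $a=pd$, $b=qd$ with $p,q$ coprime positive integers and $d>0$; then $\gcd(a,b)$ denotes $d$ (for integers $a,b$ this is the usual greatest common divisor). The billiard trajectory is the path of a point that starts at the corner $(0,0)$, moves initially with slope $1$ (at 45 degrees to the edges) into the table, reflects at each edge with angle of reflection equal to angle of incidence (so all its segments have slope $\pm1$), and stops when it reaches a corner of the table. The grid points are the points $(id,jd)$ with integers $0\le i\le p$, $0\le j\le q$. An atomic square is one of the smallest slanted squares formed by the trajectory: a square contained in the table with vertices $(x-d,y)$, $(x,y-d)$, $(x+d,y)$, $(x,y+d)$, where $(x,y)$ is a grid point, all of whose four edges are contained in the trajectory. *)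

theory Defs
  imports "HOL-Analysis.Analysis"
begin

definition real_gcd :: "real \<Rightarrow> real \<Rightarrow> real" where
  "real_gcd a b = (THE d. d > 0 \<and>
     (\<exists>p q :: nat. p > 0 \<and> q > 0 \<and> coprime p q \<and> a = real p * d \<and> b = real q * d))"

lemma real_gcd_eqI:
  fixes p q :: nat
  assumes "d > 0" "p > 0" "q > 0" "coprime p q" "a = real p * d" "b = real q * d"
  shows "real_gcd a b = d"
  unfolding real_gcd_def
proof (rule the_equality)
  show "d > 0 \<and> (\<exists>p q :: nat. p > 0 \<and> q > 0 \<and> coprime p q \<and> a = real p * d \<and> b = real q * d)"
    using assms by blast
next
  fix e
  assume "e > 0 \<and> (\<exists>p q :: nat. p > 0 \<and> q > 0 \<and> coprime p q \<and> a = real p * e \<and> b = real q * e)"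
  then obtain r s :: nat where e: "e > 0" "r > 0" "s > 0" "coprime r s"
    "a = real r * e" "b = real s * e" by blast
  have "real p * d * (real s * e) = real r * e * (real q * d)"
    using assms(5,6) e(5,6) by simp
  then have "real (p * s) = real (r * q)"
    using \<open>d > 0\<close> \<open>e > 0\<close> by simp
  then have eq: "p * s = r * q"
    by (simp only: of_nat_eq_iff)
  have "p dvd r"
    using eq \<open>coprime p q\<close> by (metis coprime_dvd_mult_left_iff dvd_triv_left)
  moreover have "r dvd p"
    using eq \<open>coprime r s\<close> by (metis coprime_dvd_mult_left_iff dvd_triv_left)
  ultimately have "p = r" by (rule dvd_antisym)
  then show "e = d"
    using assms(5) e(2,5) by simp
qed

lemma real_gcd_exists:
  assumes "a > 0" "b > 0" "a / b \<in> \<rat>"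
  obtains p q :: nat where "p > 0" "q > 0" "coprime p q"
    "a = real p * real_gcd a b" "b = real q * real_gcd a b" "real_gcd a b > 0"
proof -
  from assms(3) obtain p q :: nat where pq: "q \<noteq> 0" "\<bar>a / b\<bar> = real p / real q" "coprime p q"
    by (rule Rats_abs_nat_div_natE)
  have ab: "a / b = real p / real q"
    using pq(2) assms(1,2) by simp
  then have "p > 0"
    using assms(1,2) by (cases "p = 0") auto
  define d where "d = b / real q"
  have d: "d > 0" "a = real p * d" "b = real q * d"
    using ab assms(2) pq(1) by (simp_all add: d_def field_simps)
  have "real_gcd a b = d"
    using d pq(1,3) \<open>p > 0\<close> by (intro real_gcd_eqI) auto
  then show thesis
    using that d pq(1,3) \<open>p > 0\<close> by auto
qed

lemma real_gcd_of_nat: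
  fixes m n :: nat
  assumes "m > 0" "n > 0"
  shows "real_gcd (real m) (real n) = real (gcd m n)"
proof (rule real_gcd_eqI)
  show "coprime (m div gcd m n) (n div gcd m n)"
    using assms by (intro div_gcd_coprime) auto
  show "real m = real (m div gcd m n) * real (gcd m n)"
    by (metis dvd_div_mult_self gcd_dvd1 of_nat_mult)
  show "real n = real (n div gcd m n) * real (gcd m n)"
    by (metis dvd_div_mult_self gcd_dvd2 of_nat_mult)
qed (use assms in \<open>auto simp: div_greater_zero_iff gcd_le1_nat gcd_le2_nat\<close>)

definition table :: "real \<Rightarrow> real \<Rightarrow> (real \<times> real) set" where
  "table a b = {0..a} \<times> {0..b}"

definition corners :: "real \<Rightarrow> real \<Rightarrow> (real \<times> real) set" where
  "corners a b = {0, a} \<times> {0, b}"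

text \<open>At an edge, equality of the angles of incidence and reflection means that the velocity
  component normal to the edge changes sign and the tangential one is kept.\<close>

definition reflect :: "real \<Rightarrow> real \<Rightarrow> real \<times> real \<Rightarrow> real \<times> real \<Rightarrow> real \<times> real" where
  "reflect a b z v =
     (if fst z \<in> {0, a} then - fst v else fst v, if snd z \<in> {0, b} then - snd v else snd v)"

definition flight_time :: "real \<Rightarrow> real \<Rightarrow> real \<times> real \<Rightarrow> real \<times> real \<Rightarrow> real" where
  "flight_time a b z v = Sup {t. t \<ge> 0 \<and> z + t *\<^sub>R v \<in> table a b}"

text \<open>A state consists of a position and the velocity with which the point leaves it.\<close>

definition bounce :: "real \<Rightarrow> real \<Rightarrow> (real \<times> real) \<times> (real \<times> real) \<Rightarrow> (real \<times> real) \<times> (real \<times> real)"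
  where
  "bounce a b s =
     (let z = fst s; v = snd s; z' = z + flight_time a b z v *\<^sub>R v
      in (z', reflect a b z' v))"

definition hit_point :: "real \<Rightarrow> real \<Rightarrow> nat \<Rightarrow> real \<times> real" where
  "hit_point a b n = fst ((bounce a b ^^ n) ((0, 0), (1, 1)))"

text \<open>The segment leaving hit point \<open>n\<close> is traversed unless a corner has been reached by then;
  the starting corner, \<open>n = 0\<close>, does not count.\<close>

definition trajectory :: "real \<Rightarrow> real \<Rightarrow> (real \<times> real) set" where
  "trajectory a b =
     (\<Union>n \<in> {n. \<forall>k \<in> {1..n}. hit_point a b k \<notin> corners a b}.
        closed_segment (hit_point a b n) (hit_point a b (Suc n)))"

text \<open>With \<open>a = p * d\<close> and \<open>b = q * d\<close>, the bounds below are \<open>i \<le> p\<close> and \<open>j \<le> q\<close>.\<close>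

definition grid_points :: "real \<Rightarrow> real \<Rightarrow> (real \<times> real) set" where
  "grid_points a b = {(real i * d, real j * d) | (i :: nat) (j :: nat) d.
     d = real_gcd a b \<and> real i \<le> a / d \<and> real j \<le> b / d}"

definition slanted_square :: "real \<Rightarrow> real \<times> real \<Rightarrow> (real \<times> real) set" where
  "slanted_square d = (\<lambda>(x, y). convex hull {(x - d, y), (x, y - d), (x + d, y), (x, y + d)})"

definition slanted_square_edges :: "real \<Rightarrow> real \<times> real \<Rightarrow> (real \<times> real) set set" where
  "slanted_square_edges d = (\<lambda>(x, y).
     {closed_segment (x - d, y) (x, y - d), closed_segment (x, y - d) (x + d, y),
      closed_segment (x + d, y) (x, y + d), closed_segment (x, y + d) (x - d, y)})"

text \<open>Squares are counted as subsets of the plane.\<close>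

definition atomic_squares :: "real \<Rightarrow> real \<Rightarrow> (real \<times> real) set set" where
  "atomic_squares a b =
     {slanted_square (real_gcd a b) c | c.
        c \<in> grid_points a b \<and>
        slanted_square (real_gcd a b) c \<subseteq> table a b \<and>
        (\<forall>e \<in> slanted_square_edges (real_gcd a b) c. e \<subseteq> trajectory a b)}"

end

theory Submission
  imports Defs
begin

text \<open>
  Unfolding the table along its edges turns the trajectory into the diagonal of the plane, so at
  time \<open>t\<close> (measured by the horizontal distance travelled) the point is at
  \<open>(zigzag a t, zigzag b t)\<close>, where \<open>zigzag a\<close> is the triangle wave of period \<open>2 * a\<close>, that is, the distance from \<open>t\<close> to \<open>2 * a * \<int>\<close>.
  A corner is reached when \<open>t\<close> is a common multiple of \<open>a = p * d\<close> and \<open>b = q * d\<close>, for the first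
  time at \<open>t = p * q * d\<close> because \<open>p\<close> and \<open>q\<close> are coprime (\<open>trajectory_eq_positions\<close>).

  The trajectory can then be described without reference to time: it consists of the points
  \<open>(x, y)\<close> of the table for which \<open>x - y\<close> or \<open>x + y\<close> is an even multiple of \<open>d\<close>
  (\<open>trajectory_eq_even_diagonals\<close>). Every position has this property since \<open>zigzag a t\<close> is
  \<open>t\<close> or \<open>- t\<close> up to a multiple of \<open>2 * a\<close>. Conversely, \<open>x\<close> and \<open>y\<close> are attained simultaneously at
  any \<open>t\<close> with \<open>t \<equiv> x\<close> modulo \<open>2 * a\<close> and \<open>t \<equiv> \<plusminus> y\<close> modulo \<open>2 * b\<close>. Such a \<open>t\<close> exists by Bezout,
  and it can be moved into \<open>[0, p * q * d]\<close> since the motion is even and has period \<open>2 * p * q * d\<close>.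

  A slanted square around \<open>(i * d, j * d)\<close> fits into the table exactly if \<open>0 < i < p\<close> and
  \<open>0 < j < q\<close>, and then its edges are on the trajectory exactly if \<open>i + j\<close> is odd. As \<open>p\<close> or \<open>q\<close> is
  odd, reflecting the table in one of its axes exchanges the pairs with \<open>i + j\<close> odd and those with
  \<open>i + j\<close> even, so precisely half of the \<open>(p - 1) * (q - 1)\<close> interior grid points count
  (\<open>card_odd_interior\<close>).
\<close>

section \<open>The triangle wave\<close>

definition zigzag :: "real \<Rightarrow> real \<Rightarrow> real" where
  "zigzag a t = (if even \<lfloor>t / a\<rfloor> then t - a * \<lfloor>t / a\<rfloor> else a * (\<lfloor>t / a\<rfloor> + 1) - t)"

text \<open>At a corner of the wave this is the slope to the right, as the state of the billiard records
  the velocity after the reflection.\<close>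

definition zigzag_slope :: "real \<Rightarrow> real \<Rightarrow> real" where
  "zigzag_slope a t = (if even \<lfloor>t / a\<rfloor> then 1 else -1)"

definition next_multiple :: "real \<Rightarrow> real \<Rightarrow> real" where
  "next_multiple a t = a * (of_int \<lfloor>t / a\<rfloor> + 1)"

lemma floor_divide_bounds:
  fixes a t :: real
  assumes "a > 0"
  shows "a * of_int \<lfloor>t / a\<rfloor> \<le> t" "t < a * (of_int \<lfloor>t / a\<rfloor> + 1)"
  using floor_divide_lower[OF assms, of t] floor_divide_upper[OF assms, of t]
  by (simp_all add: mult.commute)

lemma floor_divide_eqI:
  fixes a t :: real
  assumes "a > 0" "a * of_int k \<le> t" "t < a * (of_int k + 1)"
  shows "\<lfloor>t / a\<rfloor> = k"
  using assms by (intro floor_unique) (simp_all add: field_simps)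

lemma floor_multiple_divide:
  fixes a :: real and k :: int
  assumes "a > 0"
  shows "\<lfloor>a * (of_int k + 1) / a\<rfloor> = k + 1"
  using assms by (intro floor_divide_eqI) (simp_all add: algebra_simps)

lemma zigzag_on_period:
  fixes a t :: real and k :: int
  assumes "a > 0" "a * k \<le> t" "t \<le> a * (k + 1)"
  shows "zigzag a t = (if even k then t - a * k else a * (k + 1) - t)"
proof (cases "t = a * (k + 1)")
  case True
  then show ?thesis
    using floor_multiple_divide[OF assms(1), of k] by (simp add: zigzag_def algebra_simps)
next
  case False
  then have "\<lfloor>t / a\<rfloor> = k"
    using assms by (intro floor_divide_eqI) auto
  then show ?thesis
    by (simp add: zigzag_def)
qed

lemma zigzag_self:
  assumes "a > 0" "0 \<le> t" "t \<le> a"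
  shows "zigzag a t = t"
  using zigzag_on_period[of a 0 t] assms by simp

lemma zigzag_in_range:
  assumes "a > 0"
  shows "zigzag a t \<in> {0..a}"
  using floor_divide_bounds[OF assms, of t] by (auto simp: zigzag_def algebra_simps)

lemma zigzag_minus:
  assumes "a > 0"
  shows "zigzag a (- t) = zigzag a t"
proof -
  let ?k = "\<lfloor>t / a\<rfloor>"
  have "zigzag a (- t) = (if even (- ?k - 1) then - t - a * (- ?k - 1) else a * ((- ?k - 1) + 1) - (- t))"
    using zigzag_on_period[of a "- ?k - 1" "- t"] floor_divide_bounds[OF assms, of t] assms
    by (simp add: algebra_simps)
  then show ?thesis
    by (simp add: zigzag_def algebra_simps)
qed

lemma zigzag_periodic:
  fixes m :: int
  assumes "a > 0"
  shows "zigzag a (t + 2 * a * m) = zigzag a t"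
proof -
  have "(t + 2 * a * m) / a = t / a + of_int (2 * m)"
    using assms by (simp add: field_simps)
  then have "\<lfloor>(t + 2 * a * m) / a\<rfloor> = \<lfloor>t / a\<rfloor> + 2 * m"
    by (metis floor_add_int)
  then show ?thesis
    by (simp add: zigzag_def algebra_simps)
qed

text \<open>The unfolding in algebraic form: folding back preserves the coordinate up to sign modulo the
  group \<open>2 * a * \<int>\<close>.\<close>

lemma zigzag_congruent:
  obtains m :: int where "zigzag a t = t + 2 * a * m \<or> zigzag a t = - t + 2 * a * m"
proof (cases "even \<lfloor>t / a\<rfloor>")
  case True
  then obtain m where "\<lfloor>t / a\<rfloor> = 2 * m" by blast
  then have "zigzag a t = t + 2 * a * of_int (- m)"
    by (simp add: zigzag_def)
  then show ?thesis using that by blast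
next
  case False
  then obtain m where "\<lfloor>t / a\<rfloor> = 2 * m + 1" by (rule oddE)
  then have "zigzag a t = - t + 2 * a * of_int (m + 1)"
    by (simp add: zigzag_def algebra_simps)
  then show ?thesis using that by blast
qed

lemma zigzag_wall_iff:
  assumes "a > 0"
  shows "zigzag a t \<in> {0, a} \<longleftrightarrow> (\<exists>k::int. t = a * k)"
proof
  assume "zigzag a t \<in> {0, a}"
  then have "t = a * of_int \<lfloor>t / a\<rfloor> \<or> t = a * of_int (\<lfloor>t / a\<rfloor> + 1)"
    by (auto simp: zigzag_def algebra_simps split: if_splits)
  then show "\<exists>k::int. t = a * k" by blast
next
  assume "\<exists>k::int. t = a * k"
  then obtain k :: int where "t = a * k" by blast
  then show "zigzag a t \<in> {0, a}"
    using zigzag_on_period[of a k t] assms by (simp add: algebra_simps)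
qed

lemma less_next_multiple: "a > 0 \<Longrightarrow> t < next_multiple a t"
  using floor_divide_bounds(2)[of a t] by (simp add: next_multiple_def)

lemma zigzag_linear:
  assumes "a > 0" "t \<le> s" "s \<le> next_multiple a t"
  shows "zigzag a s = zigzag a t + (s - t) * zigzag_slope a t"
  using zigzag_on_period[of a "\<lfloor>t / a\<rfloor>" s] floor_divide_bounds[OF assms(1), of t] assms
  by (simp add: zigzag_def zigzag_slope_def next_multiple_def)

lemma zigzag_slope_flip:
  assumes "a > 0" "t < s" "s \<le> next_multiple a t"
  shows "zigzag_slope a s = (if zigzag a s \<in> {0, a} then - zigzag_slope a t else zigzag_slope a t)"
proof (cases "s = next_multiple a t")
  case True
  then have floor: "\<lfloor>s / a\<rfloor> = \<lfloor>t / a\<rfloor> + 1"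
    using floor_multiple_divide[OF assms(1)] by (simp add: next_multiple_def)
  have "s = a * of_int (\<lfloor>t / a\<rfloor> + 1)"
    using True by (simp add: next_multiple_def)
  then have "zigzag a s \<in> {0, a}"
    unfolding zigzag_wall_iff[OF assms(1)] by blast
  then show ?thesis
    by (simp add: zigzag_slope_def floor)
next
  case False
  have bounds: "a * \<lfloor>t / a\<rfloor> < s" "s < a * (\<lfloor>t / a\<rfloor> + 1)"
    using False assms floor_divide_bounds[OF assms(1), of t] by (auto simp: next_multiple_def)
  have floor: "\<lfloor>s / a\<rfloor> = \<lfloor>t / a\<rfloor>"
    using bounds assms(1) by (intro floor_divide_eqI) auto
  have "zigzag a s \<notin> {0, a}"
    using bounds by (auto simp: zigzag_def floor algebra_simps)
  then show ?thesis
    by (simp add: zigzag_slope_def floor)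
qed

lemma zigzag_straight_in_range_iff:
  assumes "a > 0" "s \<ge> 0"
  shows "zigzag a t + s * zigzag_slope a t \<in> {0..a} \<longleftrightarrow> t + s \<le> next_multiple a t"
  using floor_divide_bounds[OF assms(1), of t] assms(2)
  by (auto simp: zigzag_def zigzag_slope_def next_multiple_def algebra_simps)

section \<open>The billiard motion in unfolded time\<close>

definition position :: "real \<Rightarrow> real \<Rightarrow> real \<Rightarrow> real \<times> real" where
  "position a b t = (zigzag a t, zigzag b t)"

definition velocity :: "real \<Rightarrow> real \<Rightarrow> real \<Rightarrow> real \<times> real" where
  "velocity a b t = (zigzag_slope a t, zigzag_slope b t)"

definition next_hit :: "real \<Rightarrow> real \<Rightarrow> real \<Rightarrow> real" where
  "next_hit a b t = min (next_multiple a t) (next_multiple b t)"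

definition hit_time :: "real \<Rightarrow> real \<Rightarrow> nat \<Rightarrow> real" where
  "hit_time a b n = (next_hit a b ^^ n) 0"

lemma hit_time_0 [simp]: "hit_time a b 0 = 0"
  by (simp add: hit_time_def)

lemma hit_time_Suc [simp]: "hit_time a b (Suc n) = next_hit a b (hit_time a b n)"
  by (simp add: hit_time_def)

context
  fixes a b :: real
  assumes a_pos: "a > 0" and b_pos: "b > 0"
begin

lemma less_next_hit: "t < next_hit a b t"
  using less_next_multiple[OF a_pos] less_next_multiple[OF b_pos] by (simp add: next_hit_def)

lemma position_linear:
  assumes "t \<le> s" "s \<le> next_hit a b t"
  shows "position a b s = position a b t + (s - t) *\<^sub>R velocity a b t"
  using zigzag_linear[OF a_pos assms(1)] zigzag_linear[OF b_pos assms(1)] assms(2)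
  by (simp add: position_def velocity_def next_hit_def)

lemma flight_time_eq:
  "flight_time a b (position a b t) (velocity a b t) = next_hit a b t - t"
proof -
  have "{s. s \<ge> 0 \<and> position a b t + s *\<^sub>R velocity a b t \<in> table a b} = {0..next_hit a b t - t}"
    using zigzag_straight_in_range_iff[OF a_pos, of _ t] zigzag_straight_in_range_iff[OF b_pos, of _ t]
    by (auto simp: position_def velocity_def table_def next_hit_def mem_Times_iff
          simp del: atLeastAtMost_iff) (auto simp: algebra_simps)
  then show ?thesis
    using less_next_hit[of t] by (simp add: flight_time_def)
qed

lemma bounce_position:
  "bounce a b (position a b t, velocity a b t) =
     (position a b (next_hit a b t), velocity a b (next_hit a b t))"
proof -
  have "reflect a b (position a b (next_hit a b t)) (velocity a b t) = velocity a b (next_hit a b t)"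
    using zigzag_slope_flip[OF a_pos less_next_hit] zigzag_slope_flip[OF b_pos less_next_hit]
    by (simp add: reflect_def position_def velocity_def next_hit_def)
  moreover have "position a b t + (next_hit a b t - t) *\<^sub>R velocity a b t = position a b (next_hit a b t)"
    using position_linear[of t "next_hit a b t"] less_next_hit[of t] by simp
  ultimately show ?thesis
    by (simp add: bounce_def flight_time_eq)
qed

lemma hit_point_eq: "hit_point a b n = position a b (hit_time a b n)"
proof -
  have "(bounce a b ^^ n) ((0, 0), (1, 1)) =
      (position a b (hit_time a b n), velocity a b (hit_time a b n))"
  proof (induction n)
    case 0
    show ?case
      by (simp add: position_def velocity_def zigzag_def zigzag_slope_def)
  next
    case (Suc n)
    then show ?case
      by (simp add: bounce_position)
  qed
  then show ?thesis
    by (simp add: hit_point_def)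
qed

lemma position_segment:
  assumes "t \<le> s" "s \<le> next_hit a b t"
  shows "position a b s \<in> closed_segment (position a b t) (position a b (next_hit a b t))"
proof -
  let ?h = "next_hit a b t"
  have "position a b ?h = position a b t + (?h - t) *\<^sub>R velocity a b t"
    using position_linear[of t ?h] less_next_hit[of t] by simp
  then have "position a b s = position a b t + ((s - t) / (?h - t)) *\<^sub>R (position a b ?h - position a b t)"
    using position_linear[OF assms] less_next_hit[of t] by simp
  moreover have "(s - t) / (?h - t) \<in> {0..1}"
    using assms less_next_hit[of t] by simp
  ultimately show ?thesis
    by (auto simp: in_segment algebra_simps)
qed

lemma segment_position:
  assumes "z \<in> closed_segment (position a b t) (position a b (next_hit a b t))"
  obtains s where "t \<le> s" "s \<le> next_hit a b t" "z = position a b s"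
proof -
  let ?h = "next_hit a b t"
  obtain u where u: "0 \<le> u" "u \<le> 1" "z = (1 - u) *\<^sub>R position a b t + u *\<^sub>R position a b ?h"
    using assms by (auto simp: in_segment)
  have h: "position a b ?h = position a b t + (?h - t) *\<^sub>R velocity a b t"
    using position_linear[of t ?h] less_next_hit[of t] by simp
  define w where "w = u * (?h - t)"
  have "0 \<le> w" "w \<le> ?h - t"
    unfolding w_def using u(1,2) less_next_hit[of t] by (auto intro: mult_left_le_one_le)
  then have bounds: "t \<le> t + w" "t + w \<le> ?h"
    by linarith+
  have "z = position a b t + w *\<^sub>R velocity a b t"
    unfolding u(3) h w_def by (simp add: algebra_simps)
  then have "z = position a b (t + w)"
    using position_linear[OF bounds] by simp
  with bounds show thesis
    using that by blast
qed

lemma strict_mono_hit_time: "strict_mono (hit_time a b)"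
  using less_next_hit by (simp add: strict_mono_Suc_iff)

text \<open>The hit times cannot accumulate, since each hit increases the total number of multiples of \<open>a\<close>
  and of \<open>b\<close> passed so far, and this number is bounded linearly in the time.\<close>

lemma hit_time_unbounded: "\<exists>n. t \<le> hit_time a b n"
proof -
  let ?c = "\<lambda>t. \<lfloor>t / a\<rfloor> + \<lfloor>t / b\<rfloor>"
  have step: "?c t + 1 \<le> ?c (next_hit a b t)" for t
  proof -
    have "\<lfloor>t / a\<rfloor> \<le> \<lfloor>next_hit a b t / a\<rfloor>" "\<lfloor>t / b\<rfloor> \<le> \<lfloor>next_hit a b t / b\<rfloor>"
      using less_next_hit[of t] a_pos b_pos by (auto intro!: floor_mono divide_right_mono)
    moreover have "\<lfloor>next_hit a b t / a\<rfloor> = \<lfloor>t / a\<rfloor> + 1 \<or> \<lfloor>next_hit a b t / b\<rfloor> = \<lfloor>t / b\<rfloor> + 1"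
      using floor_multiple_divide[OF a_pos] floor_multiple_divide[OF b_pos]
      by (simp add: next_hit_def next_multiple_def min_def)
    ultimately show ?thesis by linarith
  qed
  have count: "int n \<le> ?c (hit_time a b n)" for n
    by (induction n) (use step in \<open>auto intro: order_trans[OF _ step]\<close>)
  have "real n \<le> hit_time a b n * (1 / a + 1 / b)" for n
  proof -
    have "real n \<le> of_int (?c (hit_time a b n))"
      using count[of n] by linarith
    also have "\<dots> \<le> hit_time a b n / a + hit_time a b n / b"
      using of_int_floor_le[of "hit_time a b n / a"] of_int_floor_le[of "hit_time a b n / b"]
      unfolding of_int_add by (rule add_mono)
    finally show ?thesis by (simp add: algebra_simps)
  qed
  moreover obtain n where "t * (1 / a + 1 / b) \<le> real n"
    using real_arch_simple by blast
  ultimately have "t * (1 / a + 1 / b) \<le> hit_time a b n * (1 / a + 1 / b)"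
    using order_trans by blast
  then have "t \<le> hit_time a b n"
    using a_pos b_pos by (simp add: add_pos_pos mult_le_cancel_right)
  then show ?thesis ..
qed

lemma between_hit_times:
  assumes "t > 0"
  obtains n where "hit_time a b n < t" "t \<le> hit_time a b (Suc n)"
proof -
  define m where "m = (LEAST m. t \<le> hit_time a b m)"
  have m: "t \<le> hit_time a b m"
    unfolding m_def using hit_time_unbounded by (rule LeastI_ex)
  with assms obtain n where n: "m = Suc n"
    by (cases m) auto
  have "\<not> t \<le> hit_time a b n"
    by (rule not_less_Least) (use n in \<open>simp add: m_def\<close>)
  with m n that show thesis by force
qed

lemma position_in_corners_iff:
  "position a b t \<in> corners a b \<longleftrightarrow> (\<exists>k::int. t = a * k) \<and> (\<exists>k::int. t = b * k)"
  unfolding position_def corners_def mem_Times_iff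
  using zigzag_wall_iff[OF a_pos] zigzag_wall_iff[OF b_pos] by simp

end

section \<open>The trajectory of a table with commensurable sides\<close>

text \<open>The union of the diagonals, in both directions, through the grid points with even coordinate
  sum.\<close>

definition even_diagonals :: "real \<Rightarrow> (real \<times> real) set" where
  "even_diagonals d = {(x, y). \<exists>k::int. x - y = 2 * d * k \<or> x + y = 2 * d * k}"

context
  fixes p q :: nat and d :: real
  assumes p_pos: "p > 0" and q_pos: "q > 0" and d_pos: "d > 0" and coprime: "coprime p q"
begin

lemma sides_pos: "p * d > 0" "q * d > 0"
  using p_pos q_pos d_pos by auto

lemma corner_time_multiple:
  assumes "position (p * d) (q * d) t \<in> corners (p * d) (q * d)"
  obtains k :: int where "t = p * q * d * k"
proof -
  obtain k l :: int where k: "t = p * d * k" and l: "t = q * d * l"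
    using assms position_in_corners_iff[OF sides_pos] by blast
  have "real_of_int (int p * k) = real_of_int (int q * l)"
    using k l d_pos by (simp add: field_simps)
  then have "int p * k = int q * l"
    by (simp only: of_int_eq_iff)
  then have "int q dvd k"
    using coprime by (metis coprime_commute coprime_dvd_mult_right_iff coprime_int_iff dvd_triv_left)
  then obtain m where "k = int q * m" ..
  then have "t = p * q * d * m"
    using k by simp
  then show thesis
    using that by blast
qed

text \<open>The motion does not stop before time \<open>p * q * d\<close>, since the positive times at which it is in a
  corner are multiples of this least common multiple of the two sides.\<close>

lemma positions_subset_trajectory:
  "position (p * d) (q * d) ` {0..p * q * d} \<subseteq> trajectory (p * d) (q * d)"
proof
  let ?a = "p * d" and ?b = "q * d"
  fix z
  assume "z \<in> position ?a ?b ` {0..p * q * d}"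
  then obtain t where t: "0 \<le> t" "t \<le> p * q * d" and z: "z = position ?a ?b t"
    by auto
  \<comment> \<open>The strict inequality ensures that for \<open>t = p * q * d\<close> the final corner is not among the
    hits \<open>1..n\<close>.\<close>
  obtain n where n: "hit_time ?a ?b n \<le> t" "t \<le> hit_time ?a ?b (Suc n)" "n = 0 \<or> hit_time ?a ?b n < t"
  proof (cases "t = 0")
    case True
    then show thesis
      using that[of 0] less_next_hit[OF sides_pos, of 0] by simp
  next
    case False
    then show thesis
      using that between_hit_times[OF sides_pos, of t] t(1) by (metis less_eq_real_def)
  qed
  have "hit_point ?a ?b k \<notin> corners ?a ?b" if k: "k \<in> {1..n}" for k
  proof
    assume "hit_point ?a ?b k \<in> corners ?a ?b"
    then obtain l :: int where l: "hit_time ?a ?b k = p * q * d * l"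
      using corner_time_multiple hit_point_eq[OF sides_pos] by metis
    have "0 < hit_time ?a ?b k"
      using strict_monoD[OF strict_mono_hit_time[OF sides_pos], of 0 k] k by simp
    then have "l > 0"
      using l zero_less_mult_pos[of "p * q * d" "of_int l"] p_pos q_pos d_pos by simp
    then have "p * q * d * 1 \<le> p * q * d * l"
      using d_pos by (intro mult_left_mono) auto
    then have "p * q * d \<le> hit_time ?a ?b k"
      using l by simp
    also have "\<dots> \<le> hit_time ?a ?b n"
      using strict_mono_less_eq[OF strict_mono_hit_time[OF sides_pos]] k by simp
    also have "\<dots> < p * q * d"
      using n(3) k t(2) by auto
    finally show False by simp
  qed
  moreover have "z \<in> closed_segment (hit_point ?a ?b n) (hit_point ?a ?b (Suc n))"
    unfolding z hit_point_eq[OF sides_pos]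
    using position_segment[OF sides_pos, of "hit_time ?a ?b n" t] n by simp
  ultimately show "z \<in> trajectory ?a ?b"
    unfolding trajectory_def by blast
qed

lemma trajectory_subset_positions:
  "trajectory (p * d) (q * d) \<subseteq> range (position (p * d) (q * d))"
proof
  fix z
  assume "z \<in> trajectory (p * d) (q * d)"
  then obtain n where "z \<in> closed_segment (hit_point (p * d) (q * d) n) (hit_point (p * d) (q * d) (Suc n))"
    unfolding trajectory_def by blast
  then show "z \<in> range (position (p * d) (q * d))"
    unfolding hit_point_eq[OF sides_pos] hit_time_Suc
    by (rule segment_position[OF sides_pos]) blast
qed

lemma position_in_even_diagonals: "position (p * d) (q * d) t \<in> even_diagonals d"
proof -
  obtain m :: int where m: "zigzag (p * d) t = t + 2 * (p * d) * m \<or> zigzag (p * d) t = - t + 2 * (p * d) * m"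
    by (rule zigzag_congruent)
  obtain n :: int where n: "zigzag (q * d) t = t + 2 * (q * d) * n \<or> zigzag (q * d) t = - t + 2 * (q * d) * n"
    by (rule zigzag_congruent)
  let ?x = "zigzag (p * d) t" and ?y = "zigzag (q * d) t"
  have "?x - ?y = 2 * d * of_int (p * m - q * n) \<or> ?x + ?y = 2 * d * of_int (p * m + q * n)"
    using m n by (auto simp: algebra_simps)
  then show ?thesis
    unfolding even_diagonals_def position_def by blast
qed

text \<open>The motion is symmetric about time \<open>p * q * d\<close>: it returns from the final corner along
  the same path. Hence the positions at all times are those up to the final corner.\<close>

lemma position_in_first_half:
  "position (p * d) (q * d) t \<in> position (p * d) (q * d) ` {0..p * q * d}"
proof -
  let ?L = "p * q * d"
  have L: "?L > 0"
    using p_pos q_pos d_pos by simp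
  have periodic: "position (p * d) (q * d) (s + 2 * ?L * m) = position (p * d) (q * d) s" for s and m :: int
    using zigzag_periodic[OF sides_pos(1), of s "q * m"] zigzag_periodic[OF sides_pos(2), of s "p * m"]
    by (simp add: position_def mult_ac)
  have even: "position (p * d) (q * d) (- s) = position (p * d) (q * d) s" for s
    by (simp add: position_def zigzag_minus sides_pos)
  let ?m = "\<lfloor>t / (2 * ?L)\<rfloor>"
  define s where "s = t + 2 * ?L * of_int (- ?m)"
  have s: "0 \<le> s" "s < 2 * ?L"
    using floor_divide_bounds[of "2 * ?L" t] L by (simp_all add: s_def algebra_simps)
  have ts: "position (p * d) (q * d) t = position (p * d) (q * d) s"
    unfolding s_def periodic ..
  show ?thesis
  proof (cases "s \<le> ?L")
    case True
    then show ?thesis using s ts by auto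
  next
    case False
    have "position (p * d) (q * d) (- s + 2 * ?L * of_int 1) = position (p * d) (q * d) t"
      unfolding periodic even ts ..
    then have "position (p * d) (q * d) t = position (p * d) (q * d) (2 * ?L - s)"
      by simp
    moreover have "2 * ?L - s \<in> {0..?L}"
      unfolding atLeastAtMost_iff using False s by linarith
    ultimately show ?thesis by (rule image_eqI)
  qed
qed

lemma trajectory_eq_positions:
  "trajectory (p * d) (q * d) = position (p * d) (q * d) ` {0..p * q * d}"
  using positions_subset_trajectory trajectory_subset_positions position_in_first_half by blast

text \<open>A simultaneous solution of \<open>t \<equiv> x\<close> modulo \<open>2 * p * d\<close> and \<open>t \<equiv> y\<close> modulo \<open>2 * q * d\<close> exists as
  soon as \<open>x - y\<close> is a multiple of \<open>2 * d\<close>, the gcd of the moduli.\<close>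

lemma simultaneous_time:
  fixes x y :: real and k :: int
  assumes "x - y = 2 * d * k"
  obtains t where "zigzag (p * d) t = zigzag (p * d) x" "zigzag (q * d) t = zigzag (q * d) y"
proof -
  obtain u v :: int where "u * int p + v * int q = 1"
    using bezout_int[of "int p" "int q"] coprime by (metis coprime_imp_gcd_eq_1 coprime_int_iff)
  then have "k = k * (u * int p + v * int q)"
    by simp
  then have "real_of_int k = k * u * p + k * v * q"
    by (metis (no_types, lifting) distrib_left mult.assoc of_int_add of_int_mult of_int_of_nat_eq)
  then have "x - y = 2 * d * (k * u * p + k * v * q)"
    using assms by simp
  then have "x + 2 * (p * d) * of_int (- (k * u)) = y + 2 * (q * d) * of_int (k * v)"
    by (simp add: algebra_simps)
  then show thesis
    using that zigzag_periodic[OF sides_pos(1), of x "- (k * u)"]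
      zigzag_periodic[OF sides_pos(2), of y "k * v"] by metis
qed

lemma even_diagonals_positions:
  assumes "(x, y) \<in> table (p * d) (q * d)" "(x, y) \<in> even_diagonals d"
  obtains t where "(x, y) = position (p * d) (q * d) t"
proof -
  have xy: "zigzag (p * d) x = x" "zigzag (q * d) y = y" "zigzag (q * d) (- y) = y"
    using assms(1) sides_pos by (auto simp: table_def zigzag_self zigzag_minus)
  \<comment> \<open>As the motion does not distinguish \<open>y\<close> from \<open>- y\<close>, the antidiagonals reduce to diagonals.\<close>
  obtain k :: int where "x - y = 2 * d * k \<or> x - (- y) = 2 * d * k"
    using assms(2) by (auto simp: even_diagonals_def)
  then obtain t where "zigzag (p * d) t = x" "zigzag (q * d) t = y"
    using simultaneous_time xy by metis
  then show thesis
    by (intro that[of t]) (simp add: position_def)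
qed

lemma trajectory_eq_even_diagonals:
  "trajectory (p * d) (q * d) = table (p * d) (q * d) \<inter> even_diagonals d"
proof (intro equalityI subsetI)
  fix z
  assume "z \<in> trajectory (p * d) (q * d)"
  then obtain t where "z = position (p * d) (q * d) t"
    using trajectory_subset_positions by blast
  then show "z \<in> table (p * d) (q * d) \<inter> even_diagonals d"
    using position_in_even_diagonals zigzag_in_range[OF sides_pos(1)] zigzag_in_range[OF sides_pos(2)]
    by (simp add: table_def position_def)
next
  fix z
  assume "z \<in> table (p * d) (q * d) \<inter> even_diagonals d"
  then show "z \<in> trajectory (p * d) (q * d)"
    unfolding trajectory_eq_positions
    by (metis IntE even_diagonals_positions position_in_first_half surj_pair)
qed

end

section \<open>Slanted squares\<close>

lemma convex_table: "convex (table a b)"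
  by (simp add: table_def convex_Times)

lemma slanted_square_vertices:
  "{(x - d, y), (x, y - d), (x + d, y), (x, y + d)} \<subseteq> slanted_square d (x, y)"
  unfolding slanted_square_def prod.case by (rule hull_subset)

lemma slanted_square_subset_table_iff:
  assumes "d > 0"
  shows "slanted_square d (x, y) \<subseteq> table a b \<longleftrightarrow> d \<le> x \<and> x \<le> a - d \<and> d \<le> y \<and> y \<le> b - d"
proof -
  have "slanted_square d (x, y) \<subseteq> table a b \<longleftrightarrow>
      {(x - d, y), (x, y - d), (x + d, y), (x, y + d)} \<subseteq> table a b"
    unfolding slanted_square_def prod.case
    by (rule subset_hull[of convex, OF convex_table])
  also have "\<dots> \<longleftrightarrow> d \<le> x \<and> x \<le> a - d \<and> d \<le> y \<and> y \<le> b - d"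
    using assms by (auto simp: table_def)
  finally show ?thesis .
qed

text \<open>A slanted square determines its center because its horizontal and vertical extents are
  centered there.\<close>

lemma slanted_square_inj:
  assumes "d > 0" "slanted_square d c = slanted_square d c'"
  shows "c = c'"
proof -
  obtain x y x' y' where c: "c = (x, y)" "c' = (x', y')"
    by fastforce
  have box: "slanted_square d (x', y') \<subseteq> {x' - d..x' + d} \<times> {y' - d..y' + d}"
    unfolding slanted_square_def prod.case
    by (rule hull_minimal) (use assms(1) in \<open>auto simp: convex_Times\<close>)
  have "{(x - d, y), (x, y - d), (x + d, y), (x, y + d)} \<subseteq> slanted_square d (x, y)"
    by (rule slanted_square_vertices)
  also have "\<dots> \<subseteq> {x' - d..x' + d} \<times> {y' - d..y' + d}"
    using box assms(2) c by simp
  finally show ?thesis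
    using c by auto
qed

lemma closed_segment_subset_antidiagonal:
  fixes x y x' y' c :: real
  assumes "x + y = c" "x' + y' = c"
  shows "closed_segment (x, y) (x', y') \<subseteq> {(u, v). u + v = c}"
proof (rule closed_segment_subset)
  have "{(u, v). u + v = c} = {z. inner (1, 1) z = c}"
    by (auto simp: inner_Pair)
  then show "convex {(u, v). u + v = c}"
    by (simp add: convex_hyperplane)
qed (use assms in auto)

lemma closed_segment_subset_diagonal:
  fixes x y x' y' c :: real
  assumes "x - y = c" "x' - y' = c"
  shows "closed_segment (x, y) (x', y') \<subseteq> {(u, v). u - v = c}"
proof (rule closed_segment_subset)
  have "{(u, v). u - v = c} = {z. inner (1, -1) z = c}"
    by (auto simp: inner_Pair)
  then show "convex {(u, v). u - v = c}"
    by (simp add: convex_hyperplane)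
qed (use assms in auto)

context
  fixes p q :: nat and d :: real
  assumes p_pos: "p > 0" and q_pos: "q > 0" and d_pos: "d > 0" and coprime: "coprime p q"
begin

text \<open>Along an edge \<open>x + y\<close> or \<open>x - y\<close> is constant, and this constant has, in units of \<open>d\<close>, the
  parity opposite to that of \<open>i + j\<close>.\<close>

lemma edges_in_trajectory_iff:
  assumes table: "slanted_square d (real i * d, real j * d) \<subseteq> table (p * d) (q * d)"
  shows "(\<forall>e \<in> slanted_square_edges d (real i * d, real j * d). e \<subseteq> trajectory (p * d) (q * d))
    \<longleftrightarrow> odd (i + j)"
proof
  assume "\<forall>e \<in> slanted_square_edges d (real i * d, real j * d). e \<subseteq> trajectory (p * d) (q * d)"
  \<comment> \<open>The midpoints of the edges lie on the trajectory in any case; it is the vertices that decide.\<close>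
  then have "(real i * d - d, real j * d) \<in> trajectory (p * d) (q * d)"
    by (auto simp: slanted_square_edges_def)
  then obtain k :: int where
      "real i * d - d - real j * d = 2 * d * k \<or> real i * d - d + real j * d = 2 * d * k"
    unfolding trajectory_eq_even_diagonals[OF p_pos q_pos d_pos coprime]
    by (auto simp: even_diagonals_def)
  then have "d * (real i - 1 - real j) = d * (2 * k) \<or> d * (real i - 1 + real j) = d * (2 * k)"
    by (simp add: algebra_simps)
  then have "real i - 1 - real j = 2 * k \<or> real i - 1 + real j = 2 * k"
    using d_pos by simp
  then have "int i - 1 - int j = 2 * k \<or> int i - 1 + int j = 2 * k"
    by linarith
  then show "odd (i + j)"
    by presburger
next
  assume "odd (i + j)"
  let ?x = "real i * d" and ?y = "real j * d"
  obtain n :: int where n: "int i + int j = 2 * n + 1"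
    using \<open>odd (i + j)\<close> by (metis oddE even_of_nat of_nat_add)
  have "real i + real j = of_int (2 * n + 1)"
    unfolding n[symmetric] by simp
  then have sum: "real i = 2 * n + 1 - real j"
    by simp
  have lines: "closed_segment (?x - d, ?y) (?x, ?y - d) \<subseteq> {(u, v). u + v = 2 * d * of_int n}"
    "closed_segment (?x, ?y - d) (?x + d, ?y) \<subseteq> {(u, v). u - v = 2 * d * of_int (n + 1 - j)}"
    "closed_segment (?x + d, ?y) (?x, ?y + d) \<subseteq> {(u, v). u + v = 2 * d * of_int (n + 1)}"
    "closed_segment (?x, ?y + d) (?x - d, ?y) \<subseteq> {(u, v). u - v = 2 * d * of_int (n - j)}"
    by (intro closed_segment_subset_antidiagonal closed_segment_subset_diagonal;
        simp add: sum algebra_simps)+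
  have vertices: "(?x - d, ?y) \<in> table (p * d) (q * d)" "(?x, ?y - d) \<in> table (p * d) (q * d)"
    "(?x + d, ?y) \<in> table (p * d) (q * d)" "(?x, ?y + d) \<in> table (p * d) (q * d)"
    using table slanted_square_vertices[of ?x d ?y] by blast+
  have diagonals: "{(u, v). u + v = 2 * d * of_int m} \<subseteq> even_diagonals d"
    "{(u, v). u - v = 2 * d * of_int m} \<subseteq> even_diagonals d" for m
    by (auto simp: even_diagonals_def)
  have "e \<subseteq> table (p * d) (q * d)" "e \<subseteq> even_diagonals d" if "e \<in> slanted_square_edges d (?x, ?y)" for e
  proof -
    show "e \<subseteq> table (p * d) (q * d)"
      using that vertices closed_segment_subset[OF _ _ convex_table]
      unfolding slanted_square_edges_def prod.case by blast
    show "e \<subseteq> even_diagonals d"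
      using that lines(1,3)[THEN order_trans, OF diagonals(1)] lines(2,4)[THEN order_trans, OF diagonals(2)]
      unfolding slanted_square_edges_def prod.case by blast
  qed
  then show "\<forall>e \<in> slanted_square_edges d (?x, ?y). e \<subseteq> trajectory (p * d) (q * d)"
    unfolding trajectory_eq_even_diagonals[OF p_pos q_pos d_pos coprime] by blast
qed

end

section \<open>Counting\<close>

definition odd_interior :: "nat \<Rightarrow> nat \<Rightarrow> (nat \<times> nat) set" where
  "odd_interior p q = {(i, j). i \<in> {1..<p} \<and> j \<in> {1..<q} \<and> odd (i + j)}"

lemma finite_odd_interior: "finite (odd_interior p q)"
  by (rule finite_subset[of _ "{1..<p} \<times> {1..<q}"]) (auto simp: odd_interior_def)

lemma card_odd_interior:
  assumes "coprime p q"
  shows "2 * card (odd_interior p q) = (p - 1) * (q - 1)"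
proof -
  define E where "E = {(i, j). i \<in> {1..<p} \<and> j \<in> {1..<q} \<and> even (i + j)}"
  have "finite E"
    by (rule finite_subset[of _ "{1..<p} \<times> {1..<q}"]) (auto simp: E_def)
  have "odd p \<or> odd q"
    using assms coprime_common_divisor_nat[of p q 2] by auto
  then have "card E = card (odd_interior p q)"
  proof
    assume "odd p"
    then have "bij_betw (\<lambda>(i, j). (p - i, j)) E (odd_interior p q)"
      by (intro bij_betw_byWitness[where f' = "\<lambda>(i, j). (p - i, j)"])
        (auto simp: E_def odd_interior_def)
    then show ?thesis by (rule bij_betw_same_card)
  next
    assume "odd q"
    then have "bij_betw (\<lambda>(i, j). (i, q - j)) E (odd_interior p q)"
      by (intro bij_betw_byWitness[where f' = "\<lambda>(i, j). (i, q - j)"])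
        (auto simp: E_def odd_interior_def)
    then show ?thesis by (rule bij_betw_same_card)
  qed
  moreover have "card E + card (odd_interior p q) = card (E \<union> odd_interior p q)"
    using \<open>finite E\<close> finite_odd_interior
    by (intro card_Un_disjoint[symmetric]) (auto simp: E_def odd_interior_def)
  moreover have "E \<union> odd_interior p q = {1..<p} \<times> {1..<q}"
    by (auto simp: E_def odd_interior_def)
  ultimately show ?thesis
    by (simp add: card_cartesian_product)
qed

lemma atomic_squares_eq:
  fixes p q :: nat and d :: real
  assumes pos: "p > 0" "q > 0" "d > 0" and coprime: "coprime p q"
  shows "atomic_squares (p * d) (q * d) =
    (\<lambda>(i, j). slanted_square d (real i * d, real j * d)) ` odd_interior p q"
proof -
  let ?a = "p * d" and ?b = "q * d"
  have gcd: "real_gcd ?a ?b = d"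
    using assms by (intro real_gcd_eqI) auto
  have grid: "grid_points ?a ?b = {(real i * d, real j * d) | i j. i \<le> p \<and> j \<le> q}"
    using pos by (auto simp: grid_points_def gcd)
  have inside: "slanted_square d (real i * d, real j * d) \<subseteq> table ?a ?b \<longleftrightarrow>
      i \<in> {1..<p} \<and> j \<in> {1..<q}" for i j
  proof -
    have "d \<le> real i * d \<longleftrightarrow> 1 \<le> i" "d \<le> real j * d \<longleftrightarrow> 1 \<le> j"
      using pos(3) by auto
    moreover have le: "real m * d \<le> real n * d - d \<longleftrightarrow> m < n" for m n :: nat
    proof -
      have "real m * d \<le> real n * d - d \<longleftrightarrow> (real m + 1) * d \<le> real n * d"
        by (simp add: algebra_simps)
      also have "\<dots> \<longleftrightarrow> m < n"
        using pos(3) by (simp add: mult_le_cancel_right) linarith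
      finally show ?thesis .
    qed
    ultimately show ?thesis
      unfolding slanted_square_subset_table_iff[OF pos(3)] by auto
  qed
  have atomic: "slanted_square d (real i * d, real j * d) \<subseteq> table ?a ?b \<and>
      (\<forall>e \<in> slanted_square_edges d (real i * d, real j * d). e \<subseteq> trajectory ?a ?b) \<longleftrightarrow>
      (i, j) \<in> odd_interior p q" for i j
    unfolding odd_interior_def mem_Collect_eq prod.case
    using inside[of i j] edges_in_trajectory_iff[OF pos coprime, of i j] by blast
  have "atomic_squares ?a ?b =
      {slanted_square d (real i * d, real j * d) | i j. i \<le> p \<and> j \<le> q \<and> (i, j) \<in> odd_interior p q}"
    unfolding atomic_squares_def gcd grid atomic[symmetric] by blast
  also have "\<dots> = (\<lambda>(i, j). slanted_square d (real i * d, real j * d)) ` odd_interior p q"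
    by (force simp: odd_interior_def)
  finally show ?thesis .
qed

theorem theorem1:
  fixes a b :: real
  assumes "a > 0" and "b > 0" and "a / b \<in> \<rat>"
  shows "finite (atomic_squares a b) \<and>
    real (card (atomic_squares a b)) =
      (a - real_gcd a b) * (b - real_gcd a b) / (2 * (real_gcd a b)\<^sup>2)"
proof -
  define d where "d = real_gcd a b"
  obtain p q :: nat where pos: "p > 0" "q > 0" "d > 0" and coprime: "coprime p q"
    and ab: "a = p * d" "b = q * d"
    using real_gcd_exists[OF assms] unfolding d_def by metis
  let ?square = "\<lambda>(i, j). slanted_square d (real i * d, real j * d)"
  have squares: "atomic_squares a b = ?square ` odd_interior p q"
    unfolding ab using atomic_squares_eq[OF pos coprime] .
  have "inj_on ?square (odd_interior p q)"
    using pos(3) by (auto simp: inj_on_def dest!: slanted_square_inj[OF pos(3)])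
  then have "card (atomic_squares a b) = card (odd_interior p q)"
    unfolding squares by (rule card_image)
  then have "2 * card (atomic_squares a b) = (p - 1) * (q - 1)"
    using card_odd_interior[OF coprime] by simp
  then have "2 * real (card (atomic_squares a b)) = real (p - 1) * real (q - 1)"
    by (metis of_nat_mult of_nat_numeral)
  then have "real (card (atomic_squares a b)) = (real p - 1) * (real q - 1) / 2"
    using pos(1,2) by (simp add: of_nat_diff)
  also have "\<dots> = (a - d) * (b - d) / (2 * d\<^sup>2)"
    unfolding ab using pos(3) by (simp add: field_simps power2_eq_square)
  finally have "real (card (atomic_squares a b)) = (a - d) * (b - d) / (2 * d\<^sup>2)" .
  moreover have "finite (atomic_squares a b)"
    unfolding squares using finite_odd_interior by (rule finite_imageI)
  ultimately show ?thesis
    unfolding d_def by blast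
qed

end
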